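(* Let $K$ be a compact Hausdorff space, let $\varepsilon\ge 0$, and let $T\in B(C(K))$ be $\varepsilon$-band preserving, where $C(K)$ carries the supremum norm. Then there exists a band preserving operator $S\in B(C(K))$ such that $\|T-S\|\le 2\varepsilon$. If $T$ is positive, then $S$ can be selected to be positive as well.
   Context: $B(X)$ denotes the space of bounded linear operators on $X$. A band in a Banach lattice $X$ is an (order) ideal $Y\subset X$ which contains $\bigvee_\alpha y_\alpha$ for every family $(y_\alpha)$ in $Y$ whose supremum exists in $X$. A linear operator $T:X\to X$ is band preserving (BP) if $T(Y)\subset Y$ for every band $Y\subset X$. A linear map $T:X\to X$ is $\varepsilon$-band preserving ($\varepsilon$-BP) if for every $x\in X$, $\sup\{\||Tx|\wedge y\| : y\ge 0,\ y\perp x\}\le\varepsilon\|x\|$. $C(K)$ is ordered pointwise. *)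

theory Defs
  imports "HOL-Analysis.Analysis" "HOL-Library.Lattice_Algebras" "HOL-Library.Lub_Glb"
begin

section \<open>Normed vector lattices\<close>

text \<open>
  Completeness is not part of this class: a Banach lattice is a complete member of it. None of
  the order-theoretic notions below refers to completeness.
\<close>

class normed_vector_lattice =
  real_normed_vector + ordered_real_vector + lattice_ab_group_add_abs +
  assumes norm_mono_abs: "\<bar>x\<bar> \<le> \<bar>y\<bar> \<Longrightarrow> norm x \<le> norm y"

instance real :: normed_vector_lattice
  by standard simp

lemma norm_abs_eq [simp]: "norm \<bar>x\<bar> = norm (x :: 'a :: normed_vector_lattice)"
  by (rule order.antisym; rule norm_mono_abs) (simp_all add: abs_of_nonneg)

lemma norm_abs_diff_le:
  fixes x y :: "'a :: normed_vector_lattice"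
  shows "norm (\<bar>x\<bar> - \<bar>y\<bar>) \<le> norm (x - y)"
  by (rule norm_mono_abs) (rule abs_triangle_ineq3)

lemma continuous_on_abs_lattice:
  fixes f :: "'a :: topological_space \<Rightarrow> 'b :: normed_vector_lattice"
  assumes "continuous_on A f"
  shows "continuous_on A (\<lambda>x. \<bar>f x\<bar>)"
proof -
  have "continuous_on UNIV (abs :: 'b \<Rightarrow> 'b)"
    unfolding continuous_on_iff dist_norm
    by (meson norm_abs_diff_le le_less_trans)
  from continuous_on_compose2[OF this assms] show ?thesis by simp
qed

lemma sup_eq_half:
  fixes x y :: "'a :: normed_vector_lattice"
  shows "sup x y = (1/2) *\<^sub>R (x + y + \<bar>x - y\<bar>)"
proof -
  have "x + y + \<bar>x - y\<bar> = sup (x + y + (x - y)) (x + y + (- (x - y)))"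
    by (simp only: abs_lattice add_sup_distrib_left)
  also have "\<dots> = sup (x + x) (y + y)"
    by (simp add: algebra_simps)
  also have "\<dots> = sup x y + sup x y"
  proof (rule order.antisym)
    show "sup (x + x) (y + y) \<le> sup x y + sup x y"
      by (intro sup_least add_mono) simp_all
    have "x + y \<le> sup (x + x) (y + y)"
    proof -
      have "(x + y) + (x + y) = (x + x) + (y + y)"
        by (simp add: algebra_simps)
      also have "\<dots> \<le> sup (x + x) (y + y) + sup (x + x) (y + y)"
        by (intro add_mono) simp_all
      finally have "0 \<le> (sup (x + x) (y + y) - (x + y)) + (sup (x + x) (y + y) - (x + y))"
        by (simp only: algebra_simps add_0)
      then show ?thesis
        by (simp only: zero_le_double_add_iff_zero_le_single_add diff_ge_0_iff_ge)
    qed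
    then show "sup x y + sup x y \<le> sup (x + x) (y + y)"
      by (simp add: add_sup_distrib_left add_sup_distrib_right add.commute)
  qed
  finally show ?thesis
    by (simp add: scaleR_2[symmetric])
qed

lemma inf_eq_neg_sup_neg:
  fixes x y :: "'a :: normed_vector_lattice"
  shows "inf x y = - sup (- x) (- y)"
  by simp

section \<open>Bounded continuous functions with the pointwise order\<close>

unbundle bcontfun.lifting

instantiation bcontfun :: (topological_space, normed_vector_lattice) normed_vector_lattice
begin

lift_definition less_eq_bcontfun :: "('a \<Rightarrow>\<^sub>C 'b) \<Rightarrow> ('a \<Rightarrow>\<^sub>C 'b) \<Rightarrow> bool"
  is "\<lambda>f g. \<forall>x. f x \<le> g x" .

definition less_bcontfun :: "('a \<Rightarrow>\<^sub>C 'b) \<Rightarrow> ('a \<Rightarrow>\<^sub>C 'b) \<Rightarrow> bool"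
  where "less_bcontfun f g \<longleftrightarrow> f \<le> g \<and> \<not> g \<le> f"

lemma abs_cont: "f \<in> bcontfun \<Longrightarrow> (\<lambda>x. \<bar>f x\<bar>) \<in> bcontfun" for f :: "'a \<Rightarrow> 'b"
  by (auto simp: bcontfun_def bounded_iff intro!: continuous_on_abs_lattice)

lemma sup_cont: "f \<in> bcontfun \<Longrightarrow> g \<in> bcontfun \<Longrightarrow> (\<lambda>x. sup (f x) (g x)) \<in> bcontfun"
  for f g :: "'a \<Rightarrow> 'b"
  unfolding sup_eq_half by (intro scaleR_cont plus_cont abs_cont minus_cont)

lemma inf_cont: "f \<in> bcontfun \<Longrightarrow> g \<in> bcontfun \<Longrightarrow> (\<lambda>x. inf (f x) (g x)) \<in> bcontfun"
  for f g :: "'a \<Rightarrow> 'b"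
  unfolding inf_eq_neg_sup_neg by (intro uminus_cont sup_cont)

lift_definition abs_bcontfun :: "('a \<Rightarrow>\<^sub>C 'b) \<Rightarrow> 'a \<Rightarrow>\<^sub>C 'b" is "\<lambda>f x. \<bar>f x\<bar>"
  by (rule abs_cont)

lift_definition sup_bcontfun :: "('a \<Rightarrow>\<^sub>C 'b) \<Rightarrow> ('a \<Rightarrow>\<^sub>C 'b) \<Rightarrow> 'a \<Rightarrow>\<^sub>C 'b"
  is "\<lambda>f g x. sup (f x) (g x)"
  by (rule sup_cont)

lift_definition inf_bcontfun :: "('a \<Rightarrow>\<^sub>C 'b) \<Rightarrow> ('a \<Rightarrow>\<^sub>C 'b) \<Rightarrow> 'a \<Rightarrow>\<^sub>C 'b"
  is "\<lambda>f g x. inf (f x) (g x)"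
  by (rule inf_cont)

instance
proof
  fix f g h :: "'a \<Rightarrow>\<^sub>C 'b" and a b :: real
  show "(f < g) = (f \<le> g \<and> \<not> g \<le> f)" by (rule less_bcontfun_def)
  show "f \<le> f" by transfer simp
  show "f \<le> g \<Longrightarrow> g \<le> h \<Longrightarrow> f \<le> h" by transfer (blast intro: order_trans)
  show "f \<le> g \<Longrightarrow> g \<le> f \<Longrightarrow> f = g" by transfer (auto intro: order.antisym)
  show "f \<le> g \<Longrightarrow> h + f \<le> h + g" by transfer simp
  show "f \<le> g \<Longrightarrow> 0 \<le> a \<Longrightarrow> a *\<^sub>R f \<le> a *\<^sub>R g" by transfer (simp add: scaleR_left_mono)
  show "a \<le> b \<Longrightarrow> 0 \<le> f \<Longrightarrow> a *\<^sub>R f \<le> b *\<^sub>R f" by transfer (simp add: scaleR_right_mono)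
  show "inf f g \<le> f" by transfer simp
  show "inf f g \<le> g" by transfer simp
  show "f \<le> g \<Longrightarrow> f \<le> h \<Longrightarrow> f \<le> inf g h" by transfer simp
  show "f \<le> sup f g" by transfer simp
  show "g \<le> sup f g" by transfer simp
  show "g \<le> f \<Longrightarrow> h \<le> f \<Longrightarrow> sup g h \<le> f" by transfer simp
  show "\<bar>f\<bar> = sup f (- f)" by transfer (simp add: abs_lattice)
  show "norm f \<le> norm g" if "\<bar>f\<bar> \<le> \<bar>g\<bar>"
  proof (rule norm_bound)
    fix x
    have "norm (f x) \<le> norm (g x)"
      using that by transfer (simp add: norm_mono_abs)
    also have "\<dots> \<le> norm g" by (rule norm_bounded)
    finally show "norm (f x) \<le> norm g" .
  qed
qed

end

section \<open>Bands and band preserving operators\<close>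

definition order_ideal :: "'a :: normed_vector_lattice set \<Rightarrow> bool" where
  "order_ideal Y \<longleftrightarrow> subspace Y \<and> (\<forall>x y. y \<in> Y \<and> \<bar>x\<bar> \<le> \<bar>y\<bar> \<longrightarrow> x \<in> Y)"

definition band :: "'a :: normed_vector_lattice set \<Rightarrow> bool" where
  "band Y \<longleftrightarrow> order_ideal Y \<and> (\<forall>A s. A \<subseteq> Y \<and> isLub UNIV A s \<longrightarrow> s \<in> Y)"

definition lattice_disjoint :: "'a :: normed_vector_lattice \<Rightarrow> 'a \<Rightarrow> bool" where
  "lattice_disjoint x y \<longleftrightarrow> inf \<bar>x\<bar> \<bar>y\<bar> = 0"

definition band_preserving :: "('a :: normed_vector_lattice \<Rightarrow> 'a) \<Rightarrow> bool" where
  "band_preserving T \<longleftrightarrow> linear T \<and> (\<forall>Y. band Y \<longrightarrow> T ` Y \<subseteq> Y)"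

text \<open>
  The supremum is over a nonempty set (it contains the value at \<open>y = 0\<close>) that is bounded above
  by \<open>norm (T x)\<close>, so the supremum operator of the reals is the true one here.
\<close>

definition eps_band_preserving :: "real \<Rightarrow> ('a :: normed_vector_lattice \<Rightarrow> 'a) \<Rightarrow> bool" where
  "eps_band_preserving \<epsilon> T \<longleftrightarrow> linear T \<and>
     (\<forall>x. (SUP y\<in>{y. 0 \<le> y \<and> lattice_disjoint y x}. norm (inf \<bar>T x\<bar> y)) \<le> \<epsilon> * norm x)"

definition positive_operator :: "('a :: normed_vector_lattice \<Rightarrow> 'a) \<Rightarrow> bool" where
  "positive_operator T \<longleftrightarrow> (\<forall>x\<ge>0. 0 \<le> T x)"

lemma eps_band_preserving_set_bounded:
  fixes T :: "'a :: normed_vector_lattice \<Rightarrow> 'a"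
  shows "bdd_above ((\<lambda>y. norm (inf \<bar>T x\<bar> y)) ` {y. 0 \<le> y \<and> lattice_disjoint y x})"
    and "0 \<in> {y. 0 \<le> y \<and> lattice_disjoint y x}"
proof -
  show "bdd_above ((\<lambda>y. norm (inf \<bar>T x\<bar> y)) ` {y. 0 \<le> y \<and> lattice_disjoint y x})"
    by (rule bdd_aboveI2[where M = "norm (T x)"]) (auto intro!: norm_mono_abs simp: abs_of_nonneg)
  show "0 \<in> {y. 0 \<le> y \<and> lattice_disjoint y x}"
    by (simp add: lattice_disjoint_def inf_absorb1)
qed

end

theory Submission
  imports Defs
begin

text \<open>
  If \<open>f t = 0\<close>, truncating \<open>f\<close> at height \<open>\<delta>\<close> changes it by at most \<open>\<delta>\<close> and leaves a function
  disjoint from a multiple of \<open>(\<delta> - |f|)\<^sup>+\<close> that is as large at \<open>t\<close> as desired; hence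
  \<open>|T f t| \<le> \<epsilon> * norm f\<close>. Applied to \<open>f - f t\<close>, which vanishes at \<open>t\<close> and has norm at most
  \<open>2 * norm f\<close>, this says that multiplication by \<open>T 1\<close> is within \<open>2 * \<epsilon>\<close> of \<open>T\<close>.
\<close>

lemma apply_bcontfun_lattice_simps [simp]:
  fixes f g :: "'a :: topological_space \<Rightarrow>\<^sub>C 'b :: normed_vector_lattice"
  shows "apply_bcontfun (sup f g) x = sup (f x) (g x)"
    and "apply_bcontfun (inf f g) x = inf (f x) (g x)"
    and "apply_bcontfun \<bar>f\<bar> x = \<bar>f x\<bar>"
  by (transfer; simp)+

lift_definition bcontfun_mult ::
  "('a :: topological_space \<Rightarrow>\<^sub>C real) \<Rightarrow> ('a \<Rightarrow>\<^sub>C real) \<Rightarrow> ('a \<Rightarrow>\<^sub>C real)"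
  is "\<lambda>f g x. f x * g x"
proof -
  fix f g :: "'a \<Rightarrow> real"
  assume "f \<in> bcontfun" "g \<in> bcontfun"
  then obtain a b where "continuous_on UNIV f" "continuous_on UNIV g"
    and a: "\<And>x. norm (f x) \<le> a" and b: "\<And>x. norm (g x) \<le> b"
    by (auto simp: bcontfun_def bounded_iff)
  moreover have "norm (f x * g x) \<le> a * b" for x
    unfolding norm_mult
    by (intro mult_mono a b norm_ge_zero order_trans[OF norm_ge_zero a])
  ultimately show "(\<lambda>x. f x * g x) \<in> bcontfun"
    by (auto simp: bcontfun_def bounded_iff intro!: continuous_intros exI[of _ "a * b"])
qed

lemma apply_bcontfun_mult [simp]: "bcontfun_mult f g x = f x * g x"
  by transfer simp

lemma bounded_linear_bcontfun_mult: "bounded_linear (bcontfun_mult \<phi>)"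
proof (rule bounded_linear_intro)
  show "bcontfun_mult \<phi> (f + g) = bcontfun_mult \<phi> f + bcontfun_mult \<phi> g" for f g
    by (rule bcontfun_eqI) (simp add: algebra_simps)
  show "bcontfun_mult \<phi> (r *\<^sub>R f) = r *\<^sub>R bcontfun_mult \<phi> f" for r f
    by (rule bcontfun_eqI) simp
  show "norm (bcontfun_mult \<phi> f) \<le> norm f * norm \<phi>" for f
  proof (rule norm_bound)
    show "norm (bcontfun_mult \<phi> f x) \<le> norm f * norm \<phi>" for x
      using mult_mono[OF norm_bounded[of f x] norm_bounded[of \<phi> x]]
      by (simp add: abs_mult mult.commute)
  qed
qed

text \<open>Pointwise, \<open>\<phi> * f\<close> is at most \<open>norm \<phi> * f\<close> in
  absolute value. The product is thus dominated by a scalar multiple of \<open>f\<close>, so it lies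
  in every order ideal that contains \<open>f\<close>.\<close>

lemma band_preserving_bcontfun_mult: "band_preserving (bcontfun_mult \<phi>)"
  unfolding band_preserving_def
proof (intro conjI allI impI subsetI)
  show "linear (bcontfun_mult \<phi>)"
    by (rule bounded_linear.linear[OF bounded_linear_bcontfun_mult])
next
  fix Y g assume Y: "band Y" and "g \<in> bcontfun_mult \<phi> ` Y"
  then obtain f where f: "f \<in> Y" and g: "g = bcontfun_mult \<phi> f"
    by blast
  have "norm \<phi> *\<^sub>R f \<in> Y"
    using Y f by (simp add: band_def order_ideal_def subspace_scale)
  moreover have "\<bar>g\<bar> \<le> \<bar>norm \<phi> *\<^sub>R f\<bar>"
  proof -
    have "\<bar>g x\<bar> \<le> \<bar>(norm \<phi> *\<^sub>R f) x\<bar>" for x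
      using norm_bounded[of \<phi> x] by (simp add: g abs_mult mult_right_mono)
    then show ?thesis
      by (simp add: less_eq_bcontfun.rep_eq)
  qed
  ultimately show "g \<in> Y"
    using Y by (auto simp: band_def order_ideal_def)
qed

lemma eps_band_preservingD:
  assumes "eps_band_preserving \<epsilon> T" and "0 \<le> y" and "lattice_disjoint y x"
  shows "norm (inf \<bar>T x\<bar> y) \<le> \<epsilon> * norm x"
proof -
  have "norm (inf \<bar>T x\<bar> y) \<le> (SUP y\<in>{y. 0 \<le> y \<and> lattice_disjoint y x}. norm (inf \<bar>T x\<bar> y))"
    by (rule cSUP_upper) (use assms eps_band_preserving_set_bounded in auto)
  also have "\<dots> \<le> \<epsilon> * norm x"
    using assms(1) by (simp add: eps_band_preserving_def)
  finally show ?thesis .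
qed

text \<open>Disjointness cannot be tested on \<open>f\<close> itself: if \<open>f\<close> takes
  nonzero values arbitrarily close to \<open>t\<close>, every function disjoint from it vanishes at
  \<open>t\<close> by continuity. Truncation yields an \<open>h\<close> that is zero on a whole
  neighbourhood of \<open>t\<close>.\<close>

lemma eps_band_preserving_at_zero:
  fixes T :: "('k :: topological_space \<Rightarrow>\<^sub>C real) \<Rightarrow>\<^sub>L ('k \<Rightarrow>\<^sub>C real)"
    and f :: "'k \<Rightarrow>\<^sub>C real"
  assumes "\<epsilon> \<ge> 0" and T: "eps_band_preserving \<epsilon> (blinfun_apply T)" and ft: "f t = 0"
  shows "\<bar>T f t\<bar> \<le> \<epsilon> * norm f"
proof -
  have approx: "\<bar>T f t\<bar> \<le> \<epsilon> * norm f + norm T * \<delta>" if "\<delta> > 0" for \<delta>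
  proof -
    let ?d = "const_bcontfun \<delta> :: 'k \<Rightarrow>\<^sub>C real"
    \<comment> \<open>\<open>c\<close> is \<open>f\<close> clamped to values between
      \<open>-\<delta>\<close> and \<open>\<delta>\<close>, so \<open>h\<close> is zero wherever
      \<open>|f| \<le> \<delta>\<close>.\<close>
    define c where "c = sup (inf f ?d) (- ?d)"
    define h where "h = f - c"
    \<comment> \<open>The factor makes \<open>y t = norm (T h)\<close>, because
      \<open>f t = 0\<close>. Hence the infimum with \<open>|T h|\<close> loses nothing at
      \<open>t\<close>.\<close>
    define y where "y = (norm (T h) / \<delta>) *\<^sub>R sup 0 (?d - \<bar>f\<bar>)"
    have c_apply: "c x = max (min (f x) \<delta>) (- \<delta>)" for x
      by (simp add: c_def sup_max inf_min)
    have y_apply: "y x = norm (T h) / \<delta> * max 0 (\<delta> - \<bar>f x\<bar>)" for x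
      by (simp add: y_def sup_max)
    have norm_c: "norm c \<le> \<delta>"
      by (rule norm_bound) (use \<open>\<delta> > 0\<close> in \<open>auto simp: c_apply\<close>)
    have norm_h: "norm h \<le> norm f"
    proof (rule norm_bound)
      show "norm (h x) \<le> norm f" for x
        using norm_bounded[of f x] \<open>\<delta> > 0\<close> by (auto simp: h_def c_apply)
    qed
    have "0 \<le> y"
      using \<open>\<delta> > 0\<close> by (simp add: less_eq_bcontfun.rep_eq y_apply)
    moreover have "lattice_disjoint y h"
      unfolding lattice_disjoint_def
    proof (rule bcontfun_eqI)
      \<comment> \<open>\<open>h\<close> vanishes where \<open>|f| \<le> \<delta>\<close>, and
        \<open>y\<close> vanishes everywhere else.\<close>
      have "y x = 0 \<or> h x = 0" for x
        by (cases "\<bar>f x\<bar> \<le> \<delta>") (auto simp: y_apply h_def c_apply)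
      then show "(inf \<bar>y\<bar> \<bar>h\<bar>) x = apply_bcontfun 0 x" for x
        by (metis abs_ge_zero abs_zero apply_bcontfun_lattice_simps(2,3) inf.absorb1 inf.absorb2
            zero_bcontfun.rep_eq)
    qed
    ultimately have "norm (inf \<bar>T h\<bar> y) \<le> \<epsilon> * norm h"
      by (rule eps_band_preservingD[OF T])
    moreover have "\<bar>T h t\<bar> = norm ((inf \<bar>T h\<bar> y) t)"
      using norm_bounded[of "T h" t] \<open>\<delta> > 0\<close> by (simp add: y_apply ft inf_min)
    ultimately have "\<bar>T h t\<bar> \<le> \<epsilon> * norm h"
      using norm_bounded[of "inf \<bar>T h\<bar> y" t] by linarith
    also have "\<dots> \<le> \<epsilon> * norm f"
      using norm_h \<open>\<epsilon> \<ge> 0\<close> by (rule mult_left_mono)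
    finally have "\<bar>T h t\<bar> \<le> \<epsilon> * norm f" .
    \<comment> \<open>The small part \<open>c\<close> is controlled by the boundedness of
      \<open>T\<close> alone; this error disappears as \<open>\<delta>\<close> tends to
      zero.\<close>
    moreover have "\<bar>T c t\<bar> \<le> norm T * \<delta>"
    proof -
      have "\<bar>T c t\<bar> \<le> norm (T c)"
        using norm_bounded[of "T c" t] by simp
      also have "\<dots> \<le> norm T * norm c"
        by (rule norm_blinfun)
      also have "\<dots> \<le> norm T * \<delta>"
        using norm_c by (simp add: mult_left_mono)
      finally show ?thesis .
    qed
    moreover have "T f t = T h t + T c t"
      by (simp add: h_def blinfun.diff_right)
    ultimately show ?thesis
      by linarith
  qed
  \<comment> \<open>The limit is one-sided because \<open>approx\<close> is available only for
    positive \<open>\<delta>\<close>.\<close>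
  have "((\<lambda>\<delta>. \<epsilon> * norm f + norm T * \<delta>) \<longlongrightarrow> \<epsilon> * norm f + norm T * 0) (at_right 0)"
    by (intro tendsto_intros)
  then have "\<bar>T f t\<bar> \<le> \<epsilon> * norm f + norm T * 0"
    by (rule tendsto_lowerbound) (auto simp: eventually_at_filter intro!: always_eventually approx)
  then show ?thesis
    by simp
qed

lemma norm_diff_mult_one_le:
  fixes T :: "('k :: topological_space \<Rightarrow>\<^sub>C real) \<Rightarrow>\<^sub>L ('k \<Rightarrow>\<^sub>C real)"
  assumes "\<epsilon> \<ge> 0" and "eps_band_preserving \<epsilon> (blinfun_apply T)"
  shows "norm (T - Blinfun (bcontfun_mult (T (const_bcontfun 1)))) \<le> 2 * \<epsilon>"
proof (rule norm_blinfun_bound)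
  let ?S = "Blinfun (bcontfun_mult (T (const_bcontfun 1)))"
  fix f :: "'k \<Rightarrow>\<^sub>C real"
  show "norm ((T - ?S) f) \<le> 2 * \<epsilon> * norm f"
  proof (rule norm_bound)
    fix t
    \<comment> \<open>The point \<open>t\<close> is fixed before \<open>g\<close> is chosen: a
      different constant is subtracted at each point, while the resulting bound is uniform in
      \<open>t\<close>.\<close>
    define g where "g = f - f t *\<^sub>R const_bcontfun 1"
    have "norm g \<le> 2 * norm f"
    proof (rule norm_bound)
      show "norm (g x) \<le> 2 * norm f" for x
        using norm_bounded[of f x] norm_bounded[of f t] by (simp add: g_def)
    qed
    then have "\<epsilon> * norm g \<le> \<epsilon> * (2 * norm f)"
      using \<open>\<epsilon> \<ge> 0\<close> by (rule mult_left_mono)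
    moreover have "\<bar>T g t\<bar> \<le> \<epsilon> * norm g"
      by (rule eps_band_preserving_at_zero[OF assms]) (simp add: g_def)
    \<comment> \<open>By linearity, \<open>T g t\<close> is \<open>T f t\<close> minus
      \<open>f t\<close> times the value of \<open>T 1\<close> at \<open>t\<close>, and that product
      is \<open>?S f t\<close>.\<close>
    moreover have "(T - ?S) f t = T g t"
      by (simp add: g_def blinfun.diff_left blinfun.diff_right blinfun.scaleR_right
          bounded_linear_Blinfun_apply[OF bounded_linear_bcontfun_mult] mult.commute)
    ultimately show "norm ((T - ?S) f t) \<le> 2 * \<epsilon> * norm f"
      by simp
  qed
qed (use assms in simp)

theorem theorem6p2:
  fixes T :: "('k :: t2_space \<Rightarrow>\<^sub>C real) \<Rightarrow>\<^sub>L ('k \<Rightarrow>\<^sub>C real)"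
    and \<epsilon> :: real
  assumes "compact (UNIV :: 'k set)"
    and "\<epsilon> \<ge> 0"
    and "eps_band_preserving \<epsilon> (blinfun_apply T)"
  shows "(\<exists>S :: ('k \<Rightarrow>\<^sub>C real) \<Rightarrow>\<^sub>L ('k \<Rightarrow>\<^sub>C real).
            band_preserving (blinfun_apply S) \<and> norm (T - S) \<le> 2 * \<epsilon>) \<and>
         (positive_operator (blinfun_apply T) \<longrightarrow>
            (\<exists>S :: ('k \<Rightarrow>\<^sub>C real) \<Rightarrow>\<^sub>L ('k \<Rightarrow>\<^sub>C real).
               band_preserving (blinfun_apply S) \<and> positive_operator (blinfun_apply S) \<and>
               norm (T - S) \<le> 2 * \<epsilon>))"
proof -
  \<comment> \<open>One operator witnesses both claims: if \<open>T\<close> is positive, then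
    \<open>?\<phi>\<close> is nonnegative as the image of the constant \<open>1\<close>, and
    multiplication by it preserves nonnegativity.\<close>
  let ?\<phi> = "T (const_bcontfun 1)"
  let ?S = "Blinfun (bcontfun_mult ?\<phi>)"
  have S: "blinfun_apply ?S = bcontfun_mult ?\<phi>"
    by (rule bounded_linear_Blinfun_apply[OF bounded_linear_bcontfun_mult])
  have "positive_operator (blinfun_apply ?S)" if "positive_operator (blinfun_apply T)"
  proof -
    have "0 \<le> ?\<phi>"
      using that by (simp add: positive_operator_def less_eq_bcontfun.rep_eq)
    then show ?thesis
      unfolding S by (simp add: positive_operator_def less_eq_bcontfun.rep_eq)
  qed
  moreover have "band_preserving (blinfun_apply ?S)"
    unfolding S by (rule band_preserving_bcontfun_mult)
  ultimately show ?thesis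
    using norm_diff_mult_one_le[OF assms(2,3)] by blast
qed

end
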